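(* If $k\geq 3$ is an odd integer, then $Z_k(0)=-1$.
   Context: For an integer $k\ge 2$ and integer $n\ge 0$, $P_k(n)=\frac{(2n+k-1)(n+1)(n+2)\cdots(n+k-2)}{(k-1)!}$. The Minakshisundaram–Pleijel zeta function of the unit sphere $S^k$ is $Z_k(s)=\sum_{n=1}^{\infty}\frac{P_k(n)}{[n(n+k-1)]^s}$, absolutely convergent for $\mathrm{Re}\,s>k/2$; it extends meromorphically to $\mathbb{C}$ with poles at most at $s\in\{k/2-n:n\in\mathbb{Z}_{\ge0}\}$, and $Z_k(0)$ denotes the value of this continuation. *)

theory Defs
  imports "HOL-Complex_Analysis.Complex_Analysis"
begin

text \<open>
  The polynomial \<open>P\<^sub>k(n)\<close>, for \<open>k \<ge> 2\<close>; the product is empty (equal to 1) for \<open>k = 2\<close>.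
\<close>
definition sphere_P :: "nat \<Rightarrow> nat \<Rightarrow> real" where
  "sphere_P k n =
     (2 * real n + real k - 1) * (\<Prod>j=1..k - 2. real n + real j) / fact (k - 1)"

text \<open>
  The Dirichlet series \<open>\<Sum>n\<ge>1. P\<^sub>k(n) / (n(n+k-1))\<^sup>s\<close>, with the summation index shifted to start
  at 0. It is meaningful only for \<open>Re s > k/2\<close>.
\<close>
definition sphere_zeta_series :: "nat \<Rightarrow> complex \<Rightarrow> complex" where
  "sphere_zeta_series k s =
     (\<Sum>m. let n = Suc m in
        of_real (sphere_P k n) / (of_nat (n * (n + k - 1)) :: complex) powr s)"

text \<open>
  The zeta function of the unit sphere is the meromorphic continuation of the series to the whole
  plane. Working with \<^const>\<open>nicely_meromorphic_on\<close> (all removable singularities removed, value 0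
  at the poles) makes the continuation unique as a total function on the complex numbers. In
  particular, a nonzero value at a point is the value of the continuation at a regular point.
\<close>
definition sphere_zeta :: "nat \<Rightarrow> complex \<Rightarrow> complex" where
  "sphere_zeta k =
     (THE f. f nicely_meromorphic_on UNIV \<and>
             (\<forall>s. Re s > real k / 2 \<longrightarrow> f s = sphere_zeta_series k s))"

end

theory Submission
  imports Defs "HOL-Real_Asymp.Real_Asymp"
begin

text \<open>
  Write \<open>k = 2d + 1\<close> and \<open>M = n + d\<close>. Then \<open>n(n + k - 1) = M\<^sup>2 - d\<^sup>2\<close>, and \<open>P\<^sub>k(n) = p(M\<^sup>2)\<close> for a polynomial
  \<open>p\<close> without constant term that vanishes at \<open>M\<^sup>2\<close> for \<open>0 < M < d\<close> and equals 1 at \<open>d\<^sup>2\<close>. Expanding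
  \<open>(1 - d\<^sup>2/M\<^sup>2)\<close> to the power \<open>-s\<close> by the binomial series expresses \<open>Z\<^sub>k(s)\<close> through the values
  \<open>\<zeta>(2s + 2l - 2j)\<close> of the Riemann zeta function, truncated to \<open>M > d\<close>, and a remainder that is
  holomorphic on a half-plane as large as desired. Only the term \<open>l = 0\<close> survives at \<open>s = 0\<close>, because
  \<open>\<zeta>\<close> has no pole at an even integer; since \<open>\<zeta>(-2j) = 0\<close> for \<open>j \<ge> 1\<close>, what remains is minus the sum of
  \<open>p(M\<^sup>2)\<close> over \<open>1 \<le> M \<le> d\<close>, which is \<open>-1\<close>.

  The continuation of \<open>\<zeta>\<close> and its values at the even integers \<open>\<le> 0\<close> come from the telescoping sum of
  \<open>(m - 1/2)\<close> to the power \<open>1 - s\<close> minus \<open>(m + 1/2)\<close> to the power \<open>1 - s\<close>: in its binomial expansion only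
  odd powers of \<open>1/(2m)\<close> occur, which gives a recursion from \<open>\<zeta>(s + 2), \<zeta>(s + 4), \<dots>\<close> to \<open>\<zeta>(s)\<close>.
\<close>

subsection \<open>Binomial remainders\<close>

text \<open>Up to sign, \<open>a gchoose n\<close> is a product of factors \<open>-a + i\<close>
  over \<open>fact n\<close>, and each factor has norm at most \<open>B + i\<close>. The bound is
  itself \<open>-B gchoose n\<close> up to sign, so it belongs to a convergent binomial
  series.\<close>

lemma norm_gbinomial_le_pochhammer:
  fixes a :: "'a :: {real_normed_field, field_char_0}"
  assumes "norm a \<le> B"
  shows   "norm (a gchoose n) \<le> pochhammer B n / fact n"
proof -
  have "0 \<le> B" using assms norm_ge_zero order_trans by blast
  have "norm (pochhammer (-a) n) \<le> pochhammer B n"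
  proof (induction n)
    case (Suc n)
    have "norm (- a + of_nat n) \<le> B + of_nat n"
      using norm_triangle_ineq[of "-a" "of_nat n"] assms by simp
    then show ?case using Suc \<open>0 \<le> B\<close>
      by (auto simp: pochhammer_Suc norm_mult intro!: mult_mono order_trans[OF norm_ge_zero Suc])
  qed auto
  then show ?thesis
    by (simp add: gbinomial_pochhammer norm_mult norm_divide norm_power divide_right_mono)
qed

text \<open>A difference rather than a tail of the series, so that it is meaningful and entire in
  \<open>a\<close> for every \<open>x\<close> other than -1.\<close>

definition binomial_remainder :: "nat \<Rightarrow> complex \<Rightarrow> complex \<Rightarrow> complex" where
  "binomial_remainder L a x = (1 + x) powr a - (\<Sum>l<L. (a gchoose l) * x ^ l)"

text \<open>The tail of the binomial series is dominated by \<open>norm x ^ L\<close> times a series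
  built from the coefficients of \<open>(1 - \<rho>) powr (-B)\<close>. What matters is that
  \<open>K\<close> is uniform in \<open>a\<close> and \<open>x\<close>.\<close>

lemma binomial_remainder_bound:
  assumes "0 \<le> \<rho>" "\<rho> < 1"
  obtains K where "K \<ge> 0"
    and "\<And>a x. norm a \<le> B \<Longrightarrow> norm x \<le> \<rho> \<Longrightarrow> norm (binomial_remainder L a x) \<le> K * norm x ^ L"
proof -
  define b where "b n = pochhammer B n / fact n" for n
  have "(\<lambda>n. ((-B) gchoose n) * (-\<rho>) ^ n) sums (1 + -\<rho>) powr (-B)"
    using assms by (intro gen_binomial_real) auto
  also have "(\<lambda>n. ((-B) gchoose n) * (-\<rho>) ^ n) = (\<lambda>n. b n * \<rho> ^ n)"
  proof
    fix n
    have "(-1) ^ n * (- \<rho>) ^ n = \<rho> ^ n"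
      by (simp add: power_mult_distrib[symmetric])
    then show "((-B) gchoose n) * (-\<rho>) ^ n = b n * \<rho> ^ n"
      by (simp add: gbinomial_pochhammer b_def mult_ac)
  qed
  finally have "summable (\<lambda>n. b n * \<rho> ^ n)" by (rule sums_summable)
  then have sum1: "summable (\<lambda>n. b (n + L) * \<rho> ^ (n + L))"
    by (subst summable_iff_shift)
  have sum: "summable (\<lambda>n. b (n + L) * \<rho> ^ n)"
  proof (cases "\<rho> = 0")
    case True
    then show ?thesis by simp
  next
    case False
    have "summable (\<lambda>n. b (n + L) * \<rho> ^ (n + L) * inverse (\<rho> ^ L))"
      by (rule summable_mult2[OF sum1])
    then show ?thesis using False by (simp add: power_add field_simps)
  qed
  \<comment> \<open>For negative \<open>B\<close> the bound is vacuous but \<open>b\<close> may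
    change sign; the absolute value keeps \<open>K\<close> nonnegative.\<close>
  define K where "K = \<bar>\<Sum>n. b (n + L) * \<rho> ^ n\<bar>"
  have "norm (binomial_remainder L a x) \<le> K * norm x ^ L"
    if a: "norm a \<le> B" and x: "norm x \<le> \<rho>" for a x
  proof -
    have B: "0 \<le> B" using a norm_ge_zero order_trans by blast
    have "(\<lambda>n. (a gchoose n) * x ^ n) sums (1 + x) powr a"
      using x assms by (intro gen_binomial_complex) auto
    then have s: "(\<lambda>n. (a gchoose (n + L)) * x ^ (n + L)) sums binomial_remainder L a x"
      unfolding binomial_remainder_def by (rule sums_split_initial_segment)
    have le: "norm ((a gchoose (n + L)) * x ^ (n + L)) \<le> b (n + L) * \<rho> ^ n * norm x ^ L" for n
    proof -
      have "norm ((a gchoose (n + L)) * x ^ (n + L)) = norm (a gchoose (n + L)) * norm x ^ n * norm x ^ L"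
        by (simp add: norm_mult norm_power power_add)
      also have "\<dots> \<le> b (n + L) * \<rho> ^ n * norm x ^ L"
        unfolding b_def using x norm_gbinomial_le_pochhammer[OF a, of "n + L"]
        by (intro mult_right_mono mult_mono power_mono) (auto intro: order_trans[OF norm_ge_zero])
      finally show ?thesis .
    qed
    have sum': "summable (\<lambda>n. b (n + L) * \<rho> ^ n * norm x ^ L)"
      using sum by (rule summable_mult2)
    have "norm (binomial_remainder L a x) \<le> (\<Sum>n. b (n + L) * \<rho> ^ n * norm x ^ L)"
      unfolding sums_unique[OF s] by (rule norm_suminf_le[OF le sum'])
    also have "\<dots> = (\<Sum>n. b (n + L) * \<rho> ^ n) * norm x ^ L"
      by (rule suminf_mult2[OF sum, symmetric])
    also have "\<dots> \<le> K * norm x ^ L"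
      unfolding K_def by (intro mult_right_mono) auto
    finally show ?thesis .
  qed
  then show ?thesis by (intro that[of K]) (auto simp: K_def)
qed

text \<open>The binomial series of a natural exponent terminates before index \<open>L\<close>. The
  point -1 is excluded because \<open>0 powr 0 = 0\<close>. Such exponents occur wherever a value is
  computed below.\<close>

lemma binomial_remainder_of_nat:
  assumes "n < L" "x \<noteq> -1"
  shows   "binomial_remainder L (of_nat n) x = 0"
proof -
  have nz: "1 + x \<noteq> 0" using assms(2) by (simp add: add_eq_0_iff)
  have "(\<Sum>l<L. (of_nat n gchoose l) * x ^ l) = (\<Sum>l\<le>n. (of_nat n gchoose l) * x ^ l)"
    using assms(1) by (intro sum.mono_neutral_right) (auto simp: binomial_gbinomial[symmetric])
  also have "\<dots> = (x + 1) ^ n"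
    by (simp add: binomial_ring binomial_gbinomial)
  finally show ?thesis using nz by (simp add: binomial_remainder_def powr_nat add.commute)
qed

lemma holomorphic_binomial_remainder:
  assumes "a holomorphic_on S" "x \<noteq> -1"
  shows   "(\<lambda>s. binomial_remainder L (a s) x) holomorphic_on S"
proof -
  have "1 + x \<noteq> 0" using assms(2) by (simp add: add_eq_0_iff)
  then show ?thesis unfolding binomial_remainder_def gbinomial_prod_rev
    by (intro holomorphic_intros assms(1)) auto
qed

section \<open>Series of binomial remainders as holomorphic functions\<close>

lemma holomorphic_on_suminf:
  fixes f :: "nat \<Rightarrow> complex \<Rightarrow> complex"
  assumes "open S" and hol: "\<And>n. f n holomorphic_on S"
    and bound: "\<And>z. z \<in> S \<Longrightarrow> \<exists>r M. 0 < r \<and> cball z r \<subseteq> S \<and> summable M \<and> (\<forall>n. \<forall>w\<in>cball z r. norm (f n w) \<le> M n)"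
  shows   "(\<lambda>z. \<Sum>n. f n z) holomorphic_on S"
proof (rule holomorphic_uniform_sequence[OF \<open>open S\<close>])
  show "(\<lambda>z. \<Sum>k<n. f k z) holomorphic_on S" for n
    by (intro holomorphic_intros hol)
next
  fix z assume "z \<in> S"
  from bound[OF this] obtain r M where *: "0 < r" "cball z r \<subseteq> S" "summable M"
    "\<And>n w. w \<in> cball z r \<Longrightarrow> norm (f n w) \<le> M n" by blast
  have "uniform_limit (cball z r) (\<lambda>n z. \<Sum>k<n. f k z) (\<lambda>z. \<Sum>n. f n z) sequentially"
    by (rule Weierstrass_m_test[OF *(4,3)])
  with * show "\<exists>d>0. cball z d \<subseteq> S \<and> uniform_limit (cball z d) (\<lambda>n z. \<Sum>k<n. f k z) (\<lambda>z. \<Sum>n. f n z) sequentially"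
    by blast
qed

text \<open>The terms decay like \<open>Suc m + d\<close> to the power
  \<open>Re (e s) - q * L\<close>, which is summable once this exponent is below -1. Raising
  \<open>L\<close> therefore enlarges the domain if \<open>q > 0\<close>. The case
  \<open>q = 1\<close> serves the zeta recursion, \<open>q = 2\<close> the sphere.\<close>

lemma remainder_series:
  fixes e a :: "complex \<Rightarrow> complex" and x :: "nat \<Rightarrow> complex" and q L :: nat
  assumes S: "open S" and e: "e holomorphic_on S" and a: "a holomorphic_on S"
    and \<rho>: "0 \<le> \<rho>" "\<rho> < 1" "\<And>m. norm (x m) \<le> \<rho>"
    and x: "\<And>m. norm (x m) \<le> C / real (Suc m + d) ^ q"
    and Re_less: "\<And>s. s \<in> S \<Longrightarrow> Re (e s) < real (q * L) - 1"
  defines "t \<equiv> (\<lambda>s m. of_nat (Suc m + d) powr e s * binomial_remainder L (a s) (x m))"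
  shows   "(\<lambda>s. \<Sum>m. t s m) holomorphic_on S"
    and   "s \<in> S \<Longrightarrow> summable (t s)"
proof -
  have "0 < real (Suc 0 + d) ^ q" by (intro zero_less_power) simp
  then have C: "C \<ge> 0"
    using order_trans[OF norm_ge_zero x[of 0]] by (simp add: zero_le_divide_iff not_le[symmetric] del: of_nat_Suc of_nat_add)
  have bound: "\<exists>r M. 0 < r \<and> cball z r \<subseteq> S \<and> summable M \<and> (\<forall>n. \<forall>w\<in>cball z r. norm (t w n) \<le> M n)"
    if z: "z \<in> S" for z
  proof -
    \<comment> \<open>The slack between \<open>Re (e z)\<close> and \<open>\<eta>\<close>, like the
      added 1 in \<open>B\<close>, lets one majorant work on a whole disc around
      \<open>z\<close>.\<close>
    obtain \<eta> where \<eta>: "Re (e z) < \<eta>" "\<eta> < real (q * L) - 1"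
      using Re_less[OF z] dense by blast
    define B where "B = norm (a z) + 1"
    have ce: "isCont (\<lambda>s. Re (e s)) z" and ca: "isCont (\<lambda>s. norm (a s)) z"
      using e a S z
      by (auto intro!: continuous_intros simp: continuous_on_eq_continuous_at holomorphic_on_imp_continuous_on
          dest!: holomorphic_on_imp_continuous_on)
    have "((\<lambda>s. Re (e s)) \<longlongrightarrow> Re (e z)) (nhds z)" "((\<lambda>s. norm (a s)) \<longlongrightarrow> norm (a z)) (nhds z)"
      using ce ca tendsto_at_iff_tendsto_nhds[of "\<lambda>s. Re (e s)" z] tendsto_at_iff_tendsto_nhds[of "\<lambda>s. norm (a s)" z]
      by (simp_all add: isCont_def)
    then have "eventually (\<lambda>s. Re (e s) < \<eta>) (nhds z)" "eventually (\<lambda>s. norm (a s) < B) (nhds z)"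
      using \<eta>(1) by (simp_all add: B_def order_tendstoD(2))
    then have "eventually (\<lambda>s. Re (e s) < \<eta> \<and> norm (a s) < B \<and> s \<in> S) (nhds z)"
      using eventually_nhds_in_open[OF S z] by eventually_elim auto
    then obtain r where r: "r > 0" "\<And>s. s \<in> cball z r \<Longrightarrow> Re (e s) < \<eta> \<and> norm (a s) < B \<and> s \<in> S"
      unfolding eventually_nhds_metric_le by (auto simp: dist_commute)
    obtain K where K: "K \<ge> 0" "\<And>a x. norm a \<le> B \<Longrightarrow> norm x \<le> \<rho> \<Longrightarrow> norm (binomial_remainder L a x) \<le> K * norm x ^ L"
      using binomial_remainder_bound[OF \<rho>(1,2)] by metis
    define M where "M n = K * C ^ L * real (n + Suc d) powr (\<eta> - real (q * L))" for n
    have "summable (\<lambda>n. real n powr (\<eta> - real (q * L)))"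
      using \<eta> by (subst summable_real_powr_iff) auto
    then have "summable (\<lambda>n. real (n + Suc d) powr (\<eta> - real (q * L)))"
      by (subst summable_iff_shift)
    then have "summable M" unfolding M_def by (rule summable_mult)
    moreover have "norm (t w n) \<le> M n" if w: "w \<in> cball z r" for n w
    proof -
      have p: "real (n + Suc d) \<ge> 1" by simp
      have "norm (t w n) = real (n + Suc d) powr Re (e w) * norm (binomial_remainder L (a w) (x n))"
        unfolding t_def norm_mult by (subst norm_powr_real_powr) (auto simp: add_ac)
      also have "\<dots> \<le> real (n + Suc d) powr \<eta> * (K * norm (x n) ^ L)"
        using r(2)[OF w] p by (intro mult_mono K powr_mono \<rho>) auto
      also have "\<dots> \<le> real (n + Suc d) powr \<eta> * (K * (C / real (n + Suc d) ^ q) ^ L)"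
        using x[of n] K(1) by (intro mult_left_mono power_mono) (auto simp: add_ac)
      also have "\<dots> = M n"
      proof -
        have "real (n + Suc d) powr (\<eta> - real (q * L)) = real (n + Suc d) powr \<eta> / real (n + Suc d) ^ (q * L)"
          using p by (simp only: powr_diff powr_realpow)
        then show ?thesis by (simp only: M_def power_divide power_mult) (simp only: mult_ac times_divide_eq_left times_divide_eq_right)
      qed
      finally show ?thesis .
    qed
    ultimately show ?thesis using r by (intro exI[of _ r] exI[of _ M]) auto
  qed
  show "(\<lambda>s. \<Sum>m. t s m) holomorphic_on S"
  proof (rule holomorphic_on_suminf[OF S _ bound])
    show "(\<lambda>s. t s n) holomorphic_on S" for n
      unfolding t_def using \<rho>(2) \<rho>(3)[of n]
      by (intro holomorphic_intros holomorphic_binomial_remainder a e) (auto simp del: of_nat_Suc)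
  qed
  show "summable (t s)" if "s \<in> S"
  proof -
    from bound[OF that] obtain r M where "0 < r" "summable M" "\<forall>n. \<forall>w\<in>cball s r. norm (t w n) \<le> M n"
      by blast
    then have "summable M" "norm (t s n) \<le> M n" for n by auto
    then show ?thesis by (auto intro: summable_comparison_test)
  qed
qed

subsection \<open>Continuation of the Riemann zeta function\<close>

text \<open>
  The points \<open>1, -1, -3, \<dots>\<close>, where the recursion below divides by 0 or meets an earlier such point. In
  fact only 1 is a pole of \<open>\<zeta>\<close>.
\<close>
definition zeta_exceptional :: "complex set" where
  "zeta_exceptional = {s. (1 - s) / 2 \<in> \<nat>}"

text \<open>The exceptional set is closed under subtracting 2, so at other points the recursion
  never meets an exceptional one.\<close>

lemma zeta_exceptional_shift:
  assumes "s \<notin> zeta_exceptional"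
  shows   "s + 2 * of_nat i \<notin> zeta_exceptional"
proof
  assume "s + 2 * of_nat i \<in> zeta_exceptional"
  then have "(1 - (s + 2 * of_nat i)) / 2 + of_nat i \<in> \<nat>"
    unfolding zeta_exceptional_def by (intro Nats_add) auto
  then show False using assms by (simp add: zeta_exceptional_def field_simps)
qed

lemma one_in_zeta_exceptional: "1 \<in> zeta_exceptional"
  by (simp add: zeta_exceptional_def)

lemma zeta_exceptional_Re_le: "s \<in> zeta_exceptional \<Longrightarrow> Re s \<le> 1"
  by (auto simp: zeta_exceptional_def elim!: Nats_cases dest!: arg_cong[where f = Re])

text \<open>By parity: \<open>1 - s\<close> would be odd. At \<open>s = 0\<close> the sphere
  expansion evaluates zeta only at even integers.\<close>

lemma even_notin_zeta_exceptional: "2 * of_int j \<notin> zeta_exceptional"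
proof
  assume "2 * of_int j \<in> zeta_exceptional"
  then obtain n where "(1 - 2 * of_int j) / 2 = (of_nat n :: complex)"
    by (auto simp: zeta_exceptional_def elim: Nats_cases)
  then have "of_int (1 - 2 * j) = (of_int (2 * int n) :: complex)"
    by (simp add: field_simps)
  then have "1 - 2 * j = 2 * int n" by (simp only: of_int_eq_iff)
  then show False by presburger
qed

definition zeta_series :: "complex \<Rightarrow> complex" where
  "zeta_series s = (\<Sum>m. of_nat (Suc m) powr (-s))"

lemma open_Re_gt: "open {s. Re s > c}"
  by (simp add: open_halfspace_Re_gt)

text \<open>A degenerate case of \<open>remainder_series\<close>: for \<open>L = 0\<close>,
  \<open>a = 0\<close> and \<open>x = 0\<close> the remainder is 1, and only the power of
  \<open>Suc m\<close> is left.\<close>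

lemma zeta_series_basic:
  shows holomorphic_zeta_series: "zeta_series holomorphic_on {s. Re s > 1}"
    and summable_zeta_series: "Re s > 1 \<Longrightarrow> summable (\<lambda>m. of_nat (Suc m) powr (-s) :: complex)"
proof -
  have 1: "binomial_remainder 0 0 0 = 1"
    by (simp add: binomial_remainder_def)
  note * = remainder_series[where S = "{s. Re s > 1}" and e = "\<lambda>s. -s" and a = "\<lambda>_. 0"
      and x = "\<lambda>_. 0" and \<rho> = 0 and C = 0 and q = 0 and L = 0 and d = 0, OF open_Re_gt]
  show "zeta_series holomorphic_on {s. Re s > 1}"
    using *(1) by (simp add: zeta_series_def[abs_def] 1 holomorphic_intros del: of_nat_Suc)
  show "summable (\<lambda>m. of_nat (Suc m) powr (-s) :: complex)" if "Re s > 1"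
    using *(2)[of s] that by (simp add: 1 holomorphic_intros del: of_nat_Suc)
qed

lemma zeta_series_sums: 
  "Re s > 1 \<Longrightarrow> (\<lambda>m. of_nat (Suc m) powr (-s)) sums zeta_series s"
  unfolding zeta_series_def by (rule summable_sums[OF summable_zeta_series])

text \<open>
  The Taylor remainder of the \<open>m\<close>-th term of the telescoping sum, with \<open>Suc m\<close> in the role of \<open>m\<close>.
\<close>
definition zeta_remainder :: "nat \<Rightarrow> complex \<Rightarrow> nat \<Rightarrow> complex" where
  "zeta_remainder L s m = of_nat (Suc m) powr (1 - s) *
     (binomial_remainder L (1 - s) (-1 / of_nat (2 * Suc m)) - binomial_remainder L (1 - s) (1 / of_nat (2 * Suc m)))"

text \<open>The series at \<open>-1/(2 Suc m)\<close> and at \<open>1/(2 Suc m)\<close> are treated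
  together, with \<open>c\<close> as the sign. Since \<open>e s = 1 - s\<close> and
  \<open>q = 1\<close>, the summability condition reads \<open>Re s > 2 - L\<close>.\<close>

lemma zeta_remainder:
  shows holomorphic_zeta_remainder: "(\<lambda>s. \<Sum>m. zeta_remainder L s m) holomorphic_on {s. Re s > 2 - real L}"
    and summable_zeta_remainder: "Re s > 2 - real L \<Longrightarrow> summable (zeta_remainder L s)"
proof -
  have n: "norm (c / of_nat (2 * Suc m) :: complex) \<le> 1 / 2"
    "norm (c / of_nat (2 * Suc m) :: complex) \<le> 1 / real (Suc m + 0) ^ 1" if "norm c = 1" for m c
    using that by (simp_all add: norm_divide norm_mult field_simps del: of_nat_Suc)
  let ?S = "{s. Re s > 2 - real L}"
  let ?t = "\<lambda>c s m. of_nat (Suc m + 0) powr (1 - s) * binomial_remainder L (1 - s) (c / of_nat (2 * Suc m))"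
  have 1: "(\<lambda>s. \<Sum>m. ?t c s m) holomorphic_on ?S" if "norm c = 1" for c
    by (rule remainder_series(1)[where S = ?S and \<rho> = "1/2" and C = 1 and q = 1 and d = 0, OF open_Re_gt _ _ _ _ n[OF that]])
       (auto intro!: holomorphic_intros)
  have 2: "summable (?t c s)" if "norm c = 1" "s \<in> ?S" for c s
    by (rule remainder_series(2)[where S = ?S and \<rho> = "1/2" and C = 1 and q = 1 and d = 0, OF open_Re_gt _ _ _ _ n[OF that(1)] _ that(2)])
       (auto intro!: holomorphic_intros)
  have eq: "zeta_remainder L s = (\<lambda>m. ?t (-1) s m - ?t 1 s m)" for s
    by (simp add: zeta_remainder_def[abs_def] algebra_simps)
  show "summable (zeta_remainder L s)" if "Re s > 2 - real L"
    unfolding eq using that by (intro summable_diff 2) auto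
  have "(\<lambda>s. (\<Sum>m. ?t (-1) s m) - (\<Sum>m. ?t 1 s m)) holomorphic_on ?S"
    by (intro holomorphic_on_diff 1) auto
  also have "?this \<longleftrightarrow> (\<lambda>s. \<Sum>m. zeta_remainder L s m) holomorphic_on ?S"
  proof (rule holomorphic_cong)
    fix s assume "s \<in> ?S"
    then show "(\<Sum>m. ?t (-1) s m) - (\<Sum>m. ?t 1 s m) = (\<Sum>m. zeta_remainder L s m)"
      unfolding eq by (intro suminf_diff 2) auto
  qed auto
  finally show "(\<lambda>s. \<Sum>m. zeta_remainder L s m) holomorphic_on ?S" .
qed

text \<open>Including the vanishing term of index \<open>2 * N + 2\<close> raises the order of the
  remainder to \<open>2 * N + 3\<close>, which ensures convergence for
  \<open>Re s > 1 - 2 * (N + 1)\<close>, as the next continuation step requires.\<close>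

lemma sum_lessThan_odd:
  fixes f :: "nat \<Rightarrow> complex"
  assumes "\<And>n. even n \<Longrightarrow> f n = 0"
  shows   "(\<Sum>l<2 * N + 3. f l) = (\<Sum>i\<le>N. f (2 * i + 1))"
proof (induction N)
  case 0
  then show ?case using assms[of 0] assms[of 2] by (simp add: eval_nat_numeral)
next
  case (Suc N)
  have "2 * Suc N + 3 = Suc (Suc (2 * N + 3))" by simp
  moreover have "f (Suc (2 * N + 3)) = 0" by (intro assms) simp
  moreover have "2 * N + 3 = 2 * Suc N + 1" by simp
  ultimately show ?case using Suc
    by (simp only: sum.lessThan_Suc sum.atMost_Suc add_0_right)
qed

text \<open>The telescoping sum equals its first term, the left-hand side. In the expansion,
  \<open>l = 1\<close> contributes \<open>(s - 1) * zeta_series s\<close>, and the higher odd powers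
  contribute zeta values further to the right.\<close>

lemma zeta_recursion:
  assumes "Re s > 1"
  shows   "(1 / 2) powr (1 - s) = (s - 1) * zeta_series s
             - (\<Sum>i=1..N. 2 * ((1 - s) gchoose (2 * i + 1)) / 2 ^ (2 * i + 1) * zeta_series (s + 2 * of_nat i))
             + (\<Sum>m. zeta_remainder (2 * N + 3) s m)"
proof -
  define a where "a = 1 - s"
  \<comment> \<open>\<open>h m\<close> and \<open>h (Suc m)\<close> belong to half-integers
    symmetric about \<open>Suc m\<close>; this symmetry cancels the even powers.\<close>
  define h where "h m = complex_of_real (real m + 1 / 2) powr a" for m
  have "h \<longlonglongrightarrow> 0"
    unfolding h_def using assms
    by (intro tendsto_neg_powr_complex_of_real) (real_asymp, simp add: a_def)
  then have h_sums: "(\<lambda>m. h m - h (Suc m)) sums h 0"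
    using telescope_sums'[of h 0] by simp
  define c where "c i = (a gchoose (2 * i + 1)) / 2 ^ (2 * i + 1)" for i
  have h_eq: "h m - h (Suc m) = - (\<Sum>i\<le>N. 2 * c i * of_nat (Suc m) powr (-(s + 2 * of_nat i))) 
                + zeta_remainder (2 * N + 3) s m" for m
  proof -
    define n :: complex where "n = of_nat (Suc m)"
    define x :: complex where "x = 1 / of_nat (2 * Suc m)"
    have n0: "n \<noteq> 0" unfolding n_def by (simp del: of_nat_Suc)
    \<comment> \<open>For a nonnegative real factor \<open>n\<close> the principal branch of
      \<open>powr\<close> is multiplicative, so \<open>n powr a\<close> can be pulled out.\<close>
    have nR: "n \<in> \<real>" "Re n \<ge> 0" by (auto simp: n_def)
    have x_n: "x = 1 / (2 * n)" by (simp add: x_def n_def)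
    have "n * (1 - x) = of_real (real m + 1 / 2)" "n * (1 + x) = of_real (real (Suc m) + 1 / 2)"
      using n0 by (simp_all add: x_n right_diff_distrib distrib_left) (simp_all add: n_def)
    then have "h m = (n * (1 - x)) powr a" "h (Suc m) = (n * (1 + x)) powr a"
      unfolding h_def by simp_all
    then have "h m - h (Suc m) = n powr a * ((1 + (-x)) powr a - (1 + x) powr a)"
      by (simp add: powr_times_real_left[OF nR] right_diff_distrib[of "n powr a"])
    also have "\<dots> = n powr a * ((\<Sum>l<2 * N + 3. (a gchoose l) * ((-x) ^ l - x ^ l)) +
       (binomial_remainder (2 * N + 3) a (-x) - binomial_remainder (2 * N + 3) a x))"
      unfolding binomial_remainder_def by (simp add: algebra_simps sum_subtractf)
    also have "\<dots> = (\<Sum>l<2 * N + 3. n powr a * ((a gchoose l) * ((-x) ^ l - x ^ l))) + zeta_remainder (2 * N + 3) s m"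
      unfolding zeta_remainder_def by (simp add: a_def n_def x_def algebra_simps sum_distrib_left)
    also have "(\<Sum>l<2 * N + 3. n powr a * ((a gchoose l) * ((-x) ^ l - x ^ l))) = 
      (\<Sum>i\<le>N. n powr a * ((a gchoose (2 * i + 1)) * ((-x) ^ (2 * i + 1) - x ^ (2 * i + 1))))"
      by (subst sum_lessThan_odd) auto
    also have "\<dots> = - (\<Sum>i\<le>N. 2 * c i * n powr (-(s + 2 * of_nat i)))"
    proof -
      have "n powr a * ((a gchoose (2 * i + 1)) * ((-x) ^ (2 * i + 1) - x ^ (2 * i + 1))) = 
            - (2 * c i * n powr (-(s + 2 * of_nat i)))" for i
      proof -
        have "n powr (-(s + 2 * of_nat i)) = n powr (a - of_nat (2 * i + 1))"
          by (simp add: a_def)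
        also have "\<dots> = n powr a / n ^ (2 * i + 1)"
          using n0 by (simp only: powr_diff powr_complexpow[OF n0])
        finally have eq: "n powr (-(s + 2 * of_nat i)) = n powr a / n ^ (2 * i + 1)" .
        have "(-x) ^ (2 * i + 1) = - (x ^ (2 * i + 1))" by simp
        moreover have "x ^ (2 * i + 1) = 1 / (2 ^ (2 * i + 1) * n ^ (2 * i + 1))"
          unfolding x_n power_divide power_mult_distrib by simp
        ultimately show ?thesis unfolding eq c_def by (simp only:) (simp add: field_simps)
      qed
      then show ?thesis unfolding sum_negf[symmetric] by (intro sum.cong refl)
    qed
    finally show ?thesis by (simp add: n_def)
  qed
  have "(\<lambda>m. - (\<Sum>i\<le>N. 2 * c i * of_nat (Suc m) powr (-(s + 2 * of_nat i))) + zeta_remainder (2 * N + 3) s m)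
     sums (- (\<Sum>i\<le>N. 2 * c i * zeta_series (s + 2 * of_nat i)) + (\<Sum>m. zeta_remainder (2 * N + 3) s m))"
    using assms by (intro sums_add sums_minus sums_sum sums_mult zeta_series_sums summable_sums summable_zeta_remainder) auto
  with h_sums have "h 0 = - (\<Sum>i\<le>N. 2 * c i * zeta_series (s + 2 * of_nat i)) + (\<Sum>m. zeta_remainder (2 * N + 3) s m)"
    unfolding h_eq by (rule sums_unique2)
  also have "(\<Sum>i\<le>N. 2 * c i * zeta_series (s + 2 * of_nat i)) = 
       2 * c 0 * zeta_series s + (\<Sum>i=1..N. 2 * c i * zeta_series (s + 2 * of_nat i))"
    unfolding atMost_atLeast0 by (subst sum.atLeast_Suc_atMost) auto
  also have "2 * c 0 = 1 - s" by (simp add: c_def a_def)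
  finally show ?thesis
    by (simp add: h_def c_def a_def algebra_simps)
qed

text \<open>Each induction step solves the recursion for the value at \<open>s\<close> and gains two
  units to the left, since \<open>s + 2 i\<close> with \<open>i \<ge> 1\<close> lies in the previous
  half-plane. The functions for different \<open>N\<close> are tied together by the series on
  \<open>Re s > 1\<close>.\<close>

lemma zeta_continuation:
  obtains f where "f meromorphic_on {s. Re s > 1 - 2 * real N}"
    and "\<And>s. Re s > 1 - 2 * real N \<Longrightarrow> s \<notin> zeta_exceptional \<Longrightarrow> f analytic_on {s}"
    and "\<And>s. Re s > 1 \<Longrightarrow> f s = zeta_series s"
    and "\<And>j. j < N \<Longrightarrow> f (- 2 * of_nat j) = (if j = 0 then - 1 / 2 else 0)"
proof -
  have "\<exists>f. f meromorphic_on {s. Re s > 1 - 2 * real N} \<and>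
    (\<forall>s. Re s > 1 - 2 * real N \<longrightarrow> s \<notin> zeta_exceptional \<longrightarrow> f analytic_on {s}) \<and>
    (\<forall>s. Re s > 1 \<longrightarrow> f s = zeta_series s) \<and>
    (\<forall>j<N. f (- 2 * of_nat j) = (if j = 0 then - 1 / 2 else 0))"
  proof (induction N)
    case 0
    have "zeta_series analytic_on {s. Re s > 1}"
      using holomorphic_zeta_series open_Re_gt analytic_on_open by blast
    then show ?case
      by (intro exI[of _ zeta_series]) (auto intro: analytic_on_imp_meromorphic_on analytic_on_subset)
  next
    case (Suc N)
    then obtain f where mero: "f meromorphic_on {s. Re s > 1 - 2 * real N}"
      and ana: "\<And>s. Re s > 1 - 2 * real N \<Longrightarrow> s \<notin> zeta_exceptional \<Longrightarrow> f analytic_on {s}"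
      and eq: "\<And>s. Re s > 1 \<Longrightarrow> f s = zeta_series s"
      and val: "\<And>j. j < N \<Longrightarrow> f (- 2 * of_nat j) = (if j = 0 then - 1 / 2 else 0)" by blast
    define c where "c s i = 2 * ((1 - s :: complex) gchoose (2 * i + 1)) / 2 ^ (2 * i + 1)" for s i
    define G where "G s = (\<Sum>m. zeta_remainder (2 * N + 3) s m)" for s
    define g where "g s = ((1 / 2) powr (1 - s) + (\<Sum>i=1..N. c s i * f (s + 2 * of_nat i)) - G s) / (s - 1)" for s
    let ?S = "{s. Re s > 1 - 2 * real (Suc N)}"
    have G: "G analytic_on ?S"
      using holomorphic_zeta_remainder[of "2 * N + 3"] open_Re_gt
      by (simp add: analytic_on_open G_def[abs_def])
    have c: "(\<lambda>s. c s i) analytic_on A" for i A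
      unfolding c_def gbinomial_prod_rev by (intro analytic_intros power_not_zero fact_nonzero) auto
    have pw: "(\<lambda>s. (1 / 2) powr (1 - s) :: complex) analytic_on A" for A
      by (intro analytic_intros) (auto simp: complex_nonpos_Reals_iff)
    have shift: "(\<lambda>s. s + 2 * of_nat i) analytic_on A" for i :: nat and A :: "complex set"
      by (intro analytic_intros)
    have "g meromorphic_on ?S"
      unfolding g_def
    proof (intro meromorphic_intros analytic_on_imp_meromorphic_on[OF c] analytic_on_imp_meromorphic_on[OF pw] analytic_on_imp_meromorphic_on[OF G])
      fix i assume "i \<in> {1..N}"
      then show "(\<lambda>s. f (s + 2 * of_nat i)) meromorphic_on ?S"
        by (intro meromorphic_on_compose[OF mero shift]) auto
    qed
    moreover have "g analytic_on {s}" if s: "s \<in> ?S" "s \<notin> zeta_exceptional" for s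
      unfolding g_def
    proof (intro analytic_intros c pw analytic_on_subset[OF G])
      fix i assume i: "i \<in> {1..N}"
      have "f analytic_on {s + 2 * of_nat i}"
        using s i by (intro ana zeta_exceptional_shift) auto
      then show "(\<lambda>s. f (s + 2 * of_nat i)) analytic_on {s}"
        using analytic_on_compose_gen[OF shift[of i "{s}"], of f] by (simp add: o_def)
    qed (use s one_in_zeta_exceptional in \<open>auto simp: complex_nonpos_Reals_iff\<close>)
    moreover have "g s = zeta_series s" if s: "Re s > 1" for s
    proof -
      have "(\<Sum>i=1..N. c s i * f (s + 2 * of_nat i)) = (\<Sum>i=1..N. c s i * zeta_series (s + 2 * of_nat i))"
        using s by (intro sum.cong refl arg_cong2[of _ _ _ _ "(*)"] eq) auto
      moreover have "s \<noteq> 1" using s by auto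
      ultimately show ?thesis
        unfolding g_def zeta_recursion[OF s, of N] G_def c_def by (simp add: field_simps)
    qed
    moreover have "g (- 2 * of_nat j) = (if j = 0 then - 1 / 2 else 0)" if j: "j < Suc N" for j
    proof -
      define s :: complex where "s = - 2 * of_nat j"
      \<comment> \<open>The exponent is a natural number below \<open>2 * N + 3\<close>, so all
        remainders vanish and the recursion becomes a finite identity.\<close>
      have s: "1 - s = of_nat (2 * j + 1)" by (simp add: s_def)
      have "zeta_remainder (2 * N + 3) s m = 0" for m
      proof -
        have "norm (1 / of_nat (2 * Suc m) :: complex) < 1" "norm (- 1 / of_nat (2 * Suc m) :: complex) < 1"
          by (simp_all only: norm_divide norm_of_nat norm_one norm_minus_cancel) (auto simp: field_simps)
        then have ne: "1 / of_nat (2 * Suc m) \<noteq> (- 1 :: complex)" "- 1 / of_nat (2 * Suc m) \<noteq> (- 1 :: complex)"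
          by (metis norm_minus_cancel norm_one less_irrefl)+
        have "2 * j + 1 < 2 * N + 3" using j by simp
        then show ?thesis
          unfolding zeta_remainder_def s
          by (simp only: binomial_remainder_of_nat[OF _ ne(1)] binomial_remainder_of_nat[OF _ ne(2)] diff_self mult_zero_right)
      qed
      then have G0: "G s = 0" by (simp add: G_def)
      have cj: "c s j = 2 / 2 ^ (2 * j + 1)" 
        unfolding c_def s binomial_gbinomial[symmetric] by simp
      \<comment> \<open>For \<open>i < j\<close> the induction hypothesis gives a zero of
        \<open>f\<close>; for \<open>i > j\<close> the binomial coefficient is 0. The term
        \<open>i = j\<close>, with \<open>f 0 = -1/2\<close>, cancels
        \<open>(1 / 2) powr (1 - s)\<close>; it is absent when \<open>j = 0\<close>.\<close>
      have "c s i * f (s + 2 * of_nat i) = (if i = j then - 1 / 2 ^ (2 * j + 1) else 0)" if i: "i \<in> {1..N}" for i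
      proof (cases "i \<le> j")
        case True
        have "s + 2 * of_nat i = - 2 * of_nat (j - i)"
          using True by (simp add: s_def of_nat_diff algebra_simps)
        then have "f (s + 2 * of_nat i) = (if j - i = 0 then - 1 / 2 else 0)"
          using i j val[of "j - i"] by auto
        then show ?thesis using True cj by auto
      next
        case False
        then have "(2 * j + 1) choose (2 * i + 1) = 0" by (intro binomial_eq_0) auto
        then have "c s i = 0" unfolding c_def s binomial_gbinomial[symmetric] by (simp only: of_nat_0 mult_zero_right div_0)
        then show ?thesis using False by simp
      qed
      then have "(\<Sum>i=1..N. c s i * f (s + 2 * of_nat i)) = (if j = 0 then 0 else - 1 / 2 ^ (2 * j + 1))"
        using j by simp
      moreover have "(1 / 2) powr (1 - s) = 1 / 2 ^ (2 * j + 1)"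
        unfolding s by (subst powr_complexpow) (auto simp: power_divide)
      ultimately have "g s = (if j = 0 then - 1 / 2 else 0)"
        unfolding g_def G0 by (auto simp: s_def)
      then show ?thesis by (simp add: s_def)
    qed
    ultimately show ?case by (intro exI[of _ g]) auto
  qed
  then show ?thesis using that by blast
qed

subsection \<open>Gluing meromorphic functions\<close>

text \<open>By the identity theorem the functions agree near every point, except perhaps at the
  point itself. Niceness then fixes the value there: 0 at a pole, the limit otherwise.\<close>

lemma nicely_meromorphic_on_unique:
  assumes f: "f nicely_meromorphic_on A" and g: "g nicely_meromorphic_on A"
    and A: "open A" "connected A" and U: "open U" "U \<noteq> {}" "U \<subseteq> A"
    and eq: "\<And>z. z \<in> U \<Longrightarrow> f z = g z" and z: "z \<in> A"
  shows   "f z = g z"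
proof -
  define h where "h z = f z - g z" for z
  have h: "h meromorphic_on A"
    using f g unfolding h_def nicely_meromorphic_on_def by (intro meromorphic_intros) auto
  have U0: "remove_sings h w = 0" if "w \<in> U" for w
  proof -
    have "h holomorphic_on U"
      using eq by (subst holomorphic_cong[of _ _ _ "\<lambda>_. 0"]) (auto simp: h_def)
    then have "h analytic_on {w}" using that U(1) analytic_at by blast
    then show ?thesis using eq[OF that] by (simp add: h_def)
  qed
  \<comment> \<open>The difference of nice functions need not be nice, for instance where two poles
    cancel; hence \<open>remove_sings\<close>.\<close>
  have "remove_sings h constant_on A"
    using U U0 A remove_sings_nicely_meromorphic[OF h]
    by (intro constant_on_extend_nicely_meromorphic_on[of _ A U]) (auto simp: constant_on_def)
  then have A0: "remove_sings h w = 0" if "w \<in> A" for w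
    using U U0 that unfolding constant_on_def by (metis equals0I subsetD)
  have "h meromorphic_on {z}" using h by (rule meromorphic_on_subset) (use z in auto)
  then have "isolated_singularity_at h z" by (simp add: meromorphic_at_iff)
  then have "eventually (\<lambda>w. remove_sings h w = h w) (at z)"
    by (rule eventually_remove_sings_eq_at)
  moreover have "eventually (\<lambda>w. w \<in> A) (at z)"
    using A z by (simp add: eventually_at_in_open')
  ultimately have ev: "eventually (\<lambda>w. f w = g w) (at z)"
    by eventually_elim (use A0 in \<open>auto simp: h_def\<close>)
  have pole: "is_pole f z \<longleftrightarrow> is_pole g z"
    by (rule is_pole_cong[OF ev refl])
  have lim: "f \<midarrow>z\<rightarrow> c \<longleftrightarrow> g \<midarrow>z\<rightarrow> c" for c
    by (rule tendsto_cong[OF ev])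
  have np: "\<not> is_pole f z" if "f \<midarrow>z\<rightarrow> c" for c
    using that not_tendsto_and_filterlim_at_infinity[OF at_neq_bot] unfolding is_pole_def by blast
  from f g z have "(is_pole f z \<and> f z = 0) \<or> f \<midarrow>z\<rightarrow> f z" "(is_pole g z \<and> g z = 0) \<or> g \<midarrow>z\<rightarrow> g z"
    unfolding nicely_meromorphic_on_def by auto
  then show ?thesis
    using pole lim np by (metis LIM_unique)
qed

lemma Re_gt_nonempty: "{s. Re s > c} \<noteq> {}"
  using gt_ex[of c] Re_complex_of_real by (metis empty_Collect_eq)

text \<open>The half-planes exhaust the plane. Once singularities are removed, uniqueness makes the
  functions agree on overlaps, because all of them equal \<open>F\<close> for
  \<open>Re s > a\<close>.\<close>

lemma nicely_meromorphic_on_glue: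
  fixes F :: "complex \<Rightarrow> complex" and a :: real
  assumes mero: "\<And>L::nat. f L meromorphic_on {s. Re s > a - real L}"
    and F: "\<And>L. f L analytic_on {s. Re s > a}" "\<And>L s. Re s > a \<Longrightarrow> f L s = F s"
  shows "\<exists>g. g nicely_meromorphic_on UNIV \<and> (\<forall>s. Re s > a \<longrightarrow> g s = F s)"
proof -
  let ?H = "\<lambda>L::nat. {s. Re s > a - real L}"
  define h where "h L = remove_sings (f L)" for L
  have h: "h L nicely_meromorphic_on ?H L" for L
    unfolding h_def by (rule remove_sings_nicely_meromorphic[OF mero])
  have hF: "h L s = F s" if "Re s > a" for L s
    using F that unfolding h_def by (subst remove_sings_at_analytic) (auto intro: analytic_on_subset)
  have le: "h L s = h L' s" if "L \<le> L'" "s \<in> ?H L" for L L' s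
  proof (rule nicely_meromorphic_on_unique[where f = "h L" and g = "h L'" and z = s and A = "?H L" and U = "{s. Re s > a}"])
    show "h L' nicely_meromorphic_on ?H L"
      using that(1) by (intro nicely_meromorphic_on_subset[OF h]) auto
    show "connected (?H L)" by (intro convex_connected convex_halfspace_Re_gt)
  qed (use that open_Re_gt Re_gt_nonempty h hF in auto)
  have any: "h L s = h L' s" if "s \<in> ?H L" "s \<in> ?H L'" for L L' s
    using le that by (metis linear)
  define n where "n s = nat \<lceil>a - Re s + 1\<rceil>" for s
  have n: "s \<in> ?H (n s)" for s
  proof -
    have "a - Re s + 1 \<le> real (n s)" unfolding n_def by linarith
    then show ?thesis by simp
  qed
  define g where "g s = h (n s) s" for s
  have gh: "g s = h L s" if "s \<in> ?H L" for s L
    unfolding g_def by (rule any[OF n that])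
  have "g nicely_meromorphic_on UNIV"
    unfolding nicely_meromorphic_on_def
  proof (intro conjI ballI)
    \<comment> \<open>The index \<open>n w\<close> varies with \<open>w\<close>, but near
      \<open>z\<close> the single function \<open>h (n z)\<close> represents
      \<open>g\<close>.\<close>
    have ev: "eventually (\<lambda>w. g w = h (n z) w) (at z)" for z
      using eventually_at_in_open'[OF open_Re_gt n, of z] by eventually_elim (use gh in auto)
    have "g meromorphic_on {z}" for z
    proof -
      have "h (n z) meromorphic_on {z}"
        using h[of "n z"] n[of z] unfolding nicely_meromorphic_on_def by (auto intro: meromorphic_on_subset)
      then show ?thesis using ev by (subst meromorphic_on_cong[of _ _ "h (n z)"]) auto
    qed
    then show "g meromorphic_on UNIV" by (subst meromorphic_on_meromorphic_at) auto
    show "is_pole g z \<and> g z = 0 \<or> g \<midarrow>z\<rightarrow> g z" for z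
    proof -
      have "is_pole (h (n z)) z \<and> h (n z) z = 0 \<or> h (n z) \<midarrow>z\<rightarrow> h (n z) z"
        using h[of "n z"] n[of z] unfolding nicely_meromorphic_on_def by auto
      then show ?thesis
        using is_pole_cong[OF ev refl] tendsto_cong[OF ev] gh[OF n] by metis
    qed
  qed
  moreover have "g s = F s" if "Re s > a" for s
    using gh[of s 0] hF[of s 0] that by simp
  ultimately show ?thesis by blast
qed

subsection \<open>The zeta function of an odd-dimensional sphere\<close>

text \<open>With \<open>M = Suc m + d\<close>, keeping \<open>L\<close> binomial terms leaves a
  remainder of order \<open>2 j - 2 Re s - 2 L\<close> in \<open>M\<close>, whence the half-plane;
  \<open>n + 1/2 < L\<close> puts 0 inside it. The term \<open>- poly p 0 / 2\<close> comes from the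
  zeta value -1/2 at 0.\<close>

lemma shifted_series_continuation:
  fixes p :: "complex poly" and d L :: nat
  defines "n \<equiv> degree p"
  defines "F \<equiv> (\<lambda>s. \<Sum>m. poly p (of_nat (Suc m + d) ^ 2) / of_nat ((Suc m + d) ^ 2 - d ^ 2) powr s)"
  obtains g where "g meromorphic_on {s. Re s > real n + 1 / 2 - real L}"
    and "g analytic_on {s. Re s > real n + 1 / 2}"
    and "\<And>s. Re s > real n + 1 / 2 \<Longrightarrow> g s = F s"
    and "real n + 1 / 2 < real L \<Longrightarrow> g analytic_on {0}"
    and "real n + 1 / 2 < real L \<Longrightarrow> g 0 = - poly p 0 / 2 - (\<Sum>M=1..d. poly p (of_nat M ^ 2))"
proof -
  let ?S = "{s. Re s > real n + 1 / 2 - real L}"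
  obtain f where f: "f meromorphic_on {s. Re s > 1 - 2 * real L}"
      "\<And>s. Re s > 1 - 2 * real L \<Longrightarrow> s \<notin> zeta_exceptional \<Longrightarrow> f analytic_on {s}"
      "\<And>s. Re s > 1 \<Longrightarrow> f s = zeta_series s"
      "\<And>j. j < L \<Longrightarrow> f (- 2 * of_nat j) = (if j = 0 then - 1 / 2 else 0)"
    using zeta_continuation[of L] by metis
  \<comment> \<open>\<open>M powr (- w l j s)\<close> collects \<open>M ^ (2 j)\<close>,
    \<open>M powr (-2 s)\<close> and the inverse of \<open>M ^ (2 l)\<close>. Below,
    \<open>A\<close> is zeta without its first \<open>d\<close> terms, since \<open>M\<close> starts
    at \<open>d + 1\<close>.\<close>
  define w where "w l j s = 2 * s + 2 * of_nat l - 2 * of_nat j" for l j and s :: complex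
  define A where "A v = f v - (\<Sum>m<d. of_nat (Suc m) powr (-v))" for v
  define x :: "nat \<Rightarrow> complex" where "x m = - (of_nat d ^ 2) / of_nat (Suc m + d) ^ 2" for m
  define h where "h j s m = of_nat (Suc m + d) powr (2 * of_nat j - 2 * s) * binomial_remainder L (-s) (x m)" for j s m
  define b where "b l s = ((-s) gchoose l) * (- (of_nat d ^ 2)) ^ l" for l and s :: complex
  define g where "g s = (\<Sum>j\<le>n. coeff p j * ((\<Sum>l<L. b l s * A (w l j s)) + (\<Sum>m. h j s m)))" for s
  \<comment> \<open>This is the norm of \<open>x 0\<close>, the largest of all
    \<open>x m\<close>.\<close>
  define \<rho> where "\<rho> = (real d / real (Suc d)) ^ 2"
  have \<rho>: "0 \<le> \<rho>" "\<rho> < 1"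
    by (simp_all add: \<rho>_def power_less_one_iff abs_square_less_1)
  have x_norm: "norm (x m) = real d ^ 2 / real (Suc m + d) ^ 2" for m
    unfolding x_def by (simp only: norm_divide norm_minus_cancel norm_power norm_of_nat)
  have x_le: "norm (x m) \<le> \<rho>" for m
    unfolding x_norm \<rho>_def power_divide by (intro divide_left_mono power_mono) auto
  have x_ne: "x m \<noteq> -1" for m
    using x_le[of m] \<rho> by auto
  note rem = remainder_series[where S = ?S and \<rho> = \<rho> and C = "real d ^ 2" and q = 2 and d = d and x = x and a = uminus and L = L,
        OF open_Re_gt _ _ \<rho> x_le eq_refl[OF x_norm], folded h_def]
  have h_hol: "(\<lambda>s. \<Sum>m. h j s m) holomorphic_on ?S" if "j \<le> n" for j
    unfolding h_def using that
    by (intro rem(1)[where e = "\<lambda>s. 2 * of_nat j - 2 * s"]) (auto intro!: holomorphic_intros)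
  have h_summable: "summable (h j s)" if "j \<le> n" "s \<in> ?S" for j s
    unfolding h_def using that
    by (intro rem(2)[where e = "\<lambda>s. 2 * of_nat j - 2 * s"]) (auto intro!: holomorphic_intros)
  have h_ana: "(\<lambda>s. \<Sum>m. h j s m) analytic_on ?S" if "j \<le> n" for j
    using h_hol[OF that] open_Re_gt by (simp add: analytic_on_open)
  have b_ana: "b l analytic_on B" for l B
    unfolding b_def[abs_def] gbinomial_prod_rev by (intro analytic_intros power_not_zero fact_nonzero)
  have w_ana: "w l j analytic_on B" for l j B
    unfolding w_def[abs_def] by (intro analytic_intros)
  have pw_ana: "(\<lambda>v. \<Sum>m<d. of_nat (Suc m) powr (-v)) analytic_on B" for B :: "complex set"
    by (intro analytic_intros) (auto simp: complex_nonpos_Reals_iff)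
  \<comment> \<open>The worst case is \<open>l = 0\<close>, \<open>j = n\<close>; it determines how
    far zeta must be continued.\<close>
  have w_Re: "Re (w l j s) > 1 - 2 * real L" if "s \<in> ?S" "j \<le> n" for l j s
    using that by (auto simp: w_def)
  have g_ana: "g analytic_on {s}" if s: "s \<in> ?S" "\<And>l j. j \<le> n \<Longrightarrow> w l j s \<notin> zeta_exceptional" for s
    unfolding g_def
  proof (intro analytic_intros b_ana analytic_on_subset[OF h_ana])
    fix j l assume "j \<in> {..n}"
    then have "A analytic_on {w l j s}"
      unfolding A_def using s w_Re by (intro analytic_intros f(2) pw_ana) auto
    then show "(\<lambda>s. A (w l j s)) analytic_on {s}"
      using analytic_on_compose_gen[OF w_ana[of l j "{s}"], of A] by (simp add: o_def)
  qed (use s in auto)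
  have w_large: "Re (w l j s) > 1" if "Re s > real n + 1 / 2" "j \<le> n" for l j s
    using that by (auto simp: w_def)
  show ?thesis
  proof (rule that[of g])
    show "g meromorphic_on ?S"
      unfolding g_def
    proof (intro meromorphic_intros analytic_on_imp_meromorphic_on[OF b_ana] analytic_on_imp_meromorphic_on[OF h_ana])
      fix j l assume "j \<in> {..n}"
      then have "w l j ` ?S \<subseteq> {s. Re s > 1 - 2 * real L}" using w_Re by auto
      moreover have "A meromorphic_on {s. Re s > 1 - 2 * real L}"
        unfolding A_def by (intro meromorphic_intros f(1) analytic_on_imp_meromorphic_on[OF pw_ana])
      ultimately show "(\<lambda>s. A (w l j s)) meromorphic_on ?S"
        by (intro meromorphic_on_compose[OF _ w_ana])
    qed auto
    show "g analytic_on {s. Re s > real n + 1 / 2}"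
      unfolding analytic_on_analytic_at[of g "{s. Re s > real n + 1 / 2}"]
    proof
      fix s assume "s \<in> {s. Re s > real n + 1 / 2}"
      then show "g analytic_on {s}"
        using w_large zeta_exceptional_Re_le by (intro g_ana) (auto simp: not_le[symmetric])
    qed
    show "g analytic_on {0}" if "real n + 1 / 2 < real L"
    proof (rule g_ana)
      fix l j
      have "w l j 0 = 2 * of_int (int l - int j)" by (simp add: w_def)
      then show "w l j 0 \<notin> zeta_exceptional" by (simp only: even_notin_zeta_exceptional not_False_eq_True)
    qed (use that in auto)
    show "g 0 = - poly p 0 / 2 - (\<Sum>M=1..d. poly p (of_nat M ^ 2))" if L: "real n + 1 / 2 < real L"
    proof -
      have "L > 0" "n < L" using L by auto
      \<comment> \<open>At \<open>s = 0\<close> the binomial exponent is 0, so the expansion is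
        exact after its first term.\<close>
      have h0: "h j 0 m = 0" for j m
        using binomial_remainder_of_nat[OF \<open>L > 0\<close> x_ne[of m]] by (simp add: h_def)
      have "(\<Sum>l<L. b l 0 * A (w l j 0)) = (if j = 0 then - 1 / 2 else 0) - (\<Sum>M=1..d. of_nat M ^ (2 * j))"
        if "j \<le> n" for j
      proof -
        have b0: "b l 0 = (if l = 0 then 1 else 0)" for l
          by (cases l) (auto simp: b_def)
        have "(\<Sum>l<L. b l 0 * A (w l j 0)) = (\<Sum>l<L. if l = 0 then A (w 0 j 0) else 0)"
          by (intro sum.cong) (auto simp: b0)
        also have "\<dots> = A (- 2 * of_nat j)"
          using \<open>L > 0\<close> by (simp add: w_def)
        also have "(\<Sum>m<d. of_nat (Suc m) powr (2 * of_nat j)) = (\<Sum>m<d. of_nat (Suc m) ^ (2 * j) :: complex)"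
        proof (rule sum.cong)
          fix m
          have "complex_of_nat (Suc m) powr of_nat (2 * j) = of_nat (Suc m) ^ (2 * j)"
            by (rule powr_complexpow) (simp del: of_nat_Suc)
          then show "complex_of_nat (Suc m) powr (2 * of_nat j) = of_nat (Suc m) ^ (2 * j)" by simp
        qed auto
        then have "A (- 2 * of_nat j) = (if j = 0 then - 1 / 2 else 0) - (\<Sum>m<d. of_nat (Suc m) ^ (2 * j))"
          unfolding A_def using f(4)[of j] that \<open>n < L\<close> by simp
        also have "(\<Sum>m<d. of_nat (Suc m) ^ (2 * j) :: complex) = (\<Sum>M=1..d. of_nat M ^ (2 * j))"
          by (rule sum.reindex_bij_witness[of _ "\<lambda>M. M - 1" Suc]) auto
        finally show ?thesis .
      qed
      then have "g 0 = (\<Sum>j\<le>n. coeff p j * ((if j = 0 then - 1 / 2 else 0) - (\<Sum>M=1..d. of_nat M ^ (2 * j))))"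
        unfolding g_def h0 by simp
      also have "\<dots> = (\<Sum>j\<le>n. if j = 0 then - coeff p 0 / 2 else 0) - (\<Sum>j\<le>n. \<Sum>M=1..d. coeff p j * of_nat M ^ (2 * j))"
        unfolding sum_subtractf[symmetric] by (intro sum.cong refl) (auto simp: sum_distrib_left right_diff_distrib)
      also have "(\<Sum>j\<le>n. \<Sum>M=1..d. coeff p j * of_nat M ^ (2 * j)) = (\<Sum>M=1..d. poly p (of_nat M ^ 2))"
        by (subst sum.swap) (simp add: poly_altdef n_def power_mult)
      finally show ?thesis by (simp add: poly_0_coeff_0)
    qed
    show "g s = F s" if s: "Re s > real n + 1 / 2" for s
    proof -
      have tail: "(\<lambda>m. of_nat (Suc m + d) powr (- w l j s)) sums A (w l j s)" if "j \<le> n" for l j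
        unfolding A_def f(3)[OF w_large[OF s that]]
        using sums_split_initial_segment[OF zeta_series_sums[OF w_large[OF s that, of l]], of d] by simp
      have "(\<lambda>m. \<Sum>j\<le>n. coeff p j * ((\<Sum>l<L. b l s * of_nat (Suc m + d) powr (- w l j s)) + h j s m)) sums g s"
        unfolding g_def using s by (intro sums_sum sums_mult sums_add tail summable_sums h_summable) auto
      moreover have "(\<Sum>j\<le>n. coeff p j * ((\<Sum>l<L. b l s * of_nat (Suc m + d) powr (- w l j s)) + h j s m)) = 
         poly p (of_nat (Suc m + d) ^ 2) / of_nat ((Suc m + d) ^ 2 - d ^ 2) powr s" for m
      proof -
        define M :: complex where "M = of_nat (Suc m + d)"
        have M0: "M \<noteq> 0" unfolding M_def of_nat_eq_0_iff by simp
        have MR: "M \<in> \<real>" "Re M \<ge> 0" "M ^ 2 \<in> \<real>" "Re (M ^ 2) \<ge> 0"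
          by (auto simp: M_def simp flip: of_nat_power)
        have xM: "x m = - (of_nat d ^ 2) / M ^ 2" by (simp add: x_def M_def)
        have "d ^ 2 \<le> (Suc m + d) ^ 2" by (intro power_mono) auto
        then have "of_nat ((Suc m + d) ^ 2 - d ^ 2) = M ^ 2 - of_nat d ^ 2"
          by (simp only: of_nat_diff of_nat_power M_def)
        also have "\<dots> = M ^ 2 * (1 + x m)" using M0 by (simp add: xM right_diff_distrib)
        finally have K: "of_nat ((Suc m + d) ^ 2 - d ^ 2) powr (-s) = M powr (-2 * s) * (1 + x m) powr (-s)"
          using powr_times_real_left[OF MR(3,4), of "1 + x m" "-s"] powr_times_real_left[OF MR(1,2), of M "-s"]
          by (simp add: power2_eq_square powr_add[symmetric])
        have "poly p (M ^ 2) / of_nat ((Suc m + d) ^ 2 - d ^ 2) powr s = 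
            poly p (M ^ 2) * of_nat ((Suc m + d) ^ 2 - d ^ 2) powr (-s)"
          by (simp only: powr_minus divide_inverse)
        also have "\<dots> = (\<Sum>j\<le>n. coeff p j * (M ^ (2 * j) * M powr (-2 * s) * (1 + x m) powr (-s)))"
          unfolding K by (simp only: poly_altdef n_def power_mult sum_distrib_right mult.assoc)
        also have "\<dots> = (\<Sum>j\<le>n. coeff p j * ((\<Sum>l<L. b l s * M powr (- w l j s)) + h j s m))"
        proof (intro sum.cong refl arg_cong2[of _ _ _ _ "(*)"])
          fix j
          have e: "M powr (2 * of_nat j - 2 * s) = M ^ (2 * j) * M powr (-2 * s)"
            using powr_complexpow[OF M0, of "2 * j"] powr_add[of M "of_nat (2 * j)" "-2 * s"] by simp
          have "b l s * M powr (- w l j s) = M powr (2 * of_nat j - 2 * s) * (((-s) gchoose l) * x m ^ l)" for l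
          proof -
            have "M powr (- w l j s) = M powr (2 * of_nat j - 2 * s) / M powr (of_nat (2 * l))"
              unfolding powr_diff[symmetric] by (rule arg_cong[of _ _ "(powr) M"]) (simp add: w_def)
            then show ?thesis
              unfolding powr_complexpow[OF M0] b_def xM power_divide power_mult
              by (simp only: mult_ac times_divide_eq_left times_divide_eq_right)
          qed
          then have "(\<Sum>l<L. b l s * M powr (- w l j s)) = M powr (2 * of_nat j - 2 * s) * (\<Sum>l<L. ((-s) gchoose l) * x m ^ l)"
            by (simp add: sum_distrib_left)
          then show "M ^ (2 * j) * M powr (-2 * s) * (1 + x m) powr (-s) = (\<Sum>l<L. b l s * M powr (- w l j s)) + h j s m"
            unfolding h_def binomial_remainder_def M_def[symmetric] e by (simp add: algebra_simps)
        qed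
        finally show ?thesis by (simp add: M_def)
      qed
      ultimately show ?thesis unfolding F_def by (simp add: sums_iff)
    qed
  qed
qed

text \<open>The factors run from \<open>M - (d - 1)\<close> to \<open>M + (d - 1)\<close>. Opposite
  ones pair to \<open>M^2 - i^2\<close>, and the middle one joins the extra \<open>M\<close>, so the
  polynomial built is \<open>X\<close> times the product of \<open>X - i^2\<close> over
  \<open>0 < i < d\<close>.\<close>

lemma sphere_product_poly:
  assumes "d \<ge> 1"
  obtains p :: "'a :: {comm_ring_1, ring_no_zero_divisors} poly" where "poly p 0 = 0" "degree p \<le> d"
    "\<And>M. M * (\<Prod>j=1..2 * d - 1. M - of_nat d + of_nat j) = poly p (M ^ 2)"
proof -
  have "\<exists>p :: 'a poly. poly p 0 = 0 \<and> degree p \<le> d \<and> (\<forall>M. M * (\<Prod>j=1..2 * d - 1. M - of_nat d + of_nat j) = poly p (M ^ 2))"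
    using assms
  proof (induction d rule: dec_induct)
    case base
    show ?case by (intro exI[of _ "[:0, 1:]"]) (auto simp: power2_eq_square)
  next
    case (step d)
    then obtain p :: "'a poly" where p: "poly p 0 = 0" "degree p \<le> d"
      "\<And>M. M * (\<Prod>j=1..2 * d - 1. M - of_nat d + of_nat j) = poly p (M ^ 2)" by blast
    define q where "q = p * [:- (of_nat d ^ 2), 1:]"
    have "M * (\<Prod>j=1..2 * Suc d - 1. M - of_nat (Suc d) + of_nat j) = poly q (M ^ 2)" for M
    proof -
      \<comment> \<open>After the index shift the new end factors, \<open>j = 0\<close> and
        \<open>j = 2 * d\<close>, are \<open>M - d\<close> and \<open>M + d\<close>.\<close>
      have "(\<Prod>j=1..2 * Suc d - 1. M - of_nat (Suc d) + of_nat j) = (\<Prod>j=0..2 * d. M - of_nat d + of_nat j)"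
        by (rule prod.reindex_bij_witness[of _ Suc "\<lambda>j. j - 1"]) (auto simp: of_nat_diff)
      also have "{0..2 * d} = insert 0 (insert (2 * d) {1..2 * d - 1})"
        using step by auto
      also have "(\<Prod>j\<in>insert 0 (insert (2 * d) {1..2 * d - 1}). M - of_nat d + of_nat j) =
          (M - of_nat d) * (M + of_nat d) * (\<Prod>j=1..2 * d - 1. M - of_nat d + of_nat j)"
        using step by (simp add: algebra_simps)
      finally have "M * (\<Prod>j=1..2 * Suc d - 1. M - of_nat (Suc d) + of_nat j) =
          M * (\<Prod>j=1..2 * d - 1. M - of_nat d + of_nat j) * (M ^ 2 - of_nat d ^ 2)"
        by (simp only: square_diff_square_factored power2_eq_square mult_ac)
      then show ?thesis
        unfolding p(3) by (simp add: q_def algebra_simps)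
    qed
    moreover have "degree q \<le> Suc d"
      using degree_mult_le[of p "[:- (of_nat d ^ 2), 1:]"] p(2) by (simp add: q_def)
    ultimately show ?case using p(1) by (intro exI[of _ q]) (auto simp: q_def)
  qed
  then show ?thesis using that by blast
qed

theorem theorem9:
  fixes k :: nat
  assumes "k \<ge> 3" and "odd k"
  shows "sphere_zeta k 0 = -1"
proof -
  obtain d where k: "k = 2 * d + 1" and d: "d \<ge> 1"
    using assms by (auto elim!: oddE)
  obtain q :: "complex poly" where q: "poly q 0 = 0" "degree q \<le> d"
    "\<And>M. M * (\<Prod>j=1..2 * d - 1. M - of_nat d + of_nat j) = poly q (M ^ 2)"
    using sphere_product_poly[OF d] by metis
  \<comment> \<open>With \<open>M = n + d\<close>, the factor \<open>2 n + k - 1\<close> is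
    \<open>2 M\<close> and the denominator \<open>(k - 1)!\<close> is \<open>(2 d)!\<close>.\<close>
  define p where "p = smult (2 / fact (2 * d)) q"
  have p0: "poly p 0 = 0" and deg: "degree p \<le> d"
    using q by (auto simp: p_def)
  define F where "F s = (\<Sum>m. poly p (of_nat (Suc m + d) ^ 2) / of_nat ((Suc m + d) ^ 2 - d ^ 2) powr s)" for s
  have F: "sphere_zeta_series k s = F s" for s
  proof -
    have "of_real (sphere_P k (Suc m)) / (of_nat (Suc m * (Suc m + k - 1)) :: complex) powr s = 
        poly p (of_nat (Suc m + d) ^ 2) / of_nat ((Suc m + d) ^ 2 - d ^ 2) powr s" for m
    proof -
      have "Suc m * (Suc m + k - 1) = (Suc m + d) ^ 2 - d ^ 2"
        unfolding k by (simp add: power2_eq_square algebra_simps)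
      moreover have "of_real (sphere_P k (Suc m)) = poly p (of_nat (Suc m + d) ^ 2)"
        unfolding p_def poly_smult q(3)[symmetric] sphere_P_def k by (simp add: field_simps)
      ultimately show ?thesis by simp
    qed
    then show ?thesis unfolding sphere_zeta_series_def F_def Let_def by simp
  qed
  have vals: "(\<Sum>M=1..d. poly p (of_nat M ^ 2)) = 1"
  proof -
    have "poly p (of_nat M ^ 2) = (if M = d then 1 else 0)" if M: "M \<in> {1..d}" for M
    proof (cases "M = d")
      case False
      then have "d - M \<in> {1..2 * d - 1}" "of_nat M - of_nat d + of_nat (d - M) = (0 :: complex)"
        using M by (auto simp: of_nat_diff)
      then have "(\<Prod>j=1..2 * d - 1. of_nat M - of_nat d + of_nat j) = (0 :: complex)"
        by (intro prod_zero) auto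
      then show ?thesis using False by (simp add: p_def q(3)[symmetric])
    next
      case True
      \<comment> \<open>At \<open>M = d\<close> the product is \<open>(2 d - 1)!\<close>, and the
        factor \<open>2 d\<close> completes it to the denominator \<open>(2 d)!\<close>.\<close>
      have "poly q (of_nat d ^ 2) = of_nat d * (\<Prod>j=1..2 * d - 1. of_nat j)"
        unfolding q(3)[symmetric] diff_self add_0_left ..
      also have "\<dots> = of_nat d * fact (2 * d - 1)"
        by (simp only: fact_prod of_nat_prod)
      finally have "2 * poly q (of_nat d ^ 2) = of_nat (2 * d) * fact (2 * d - 1)" by simp
      also have "\<dots> = fact (2 * d)"
        using d by (intro fact_reduce[symmetric]) simp
      finally have "2 / fact (2 * d) * poly q (of_nat d ^ 2) = 1"
        by (simp only: times_divide_eq_left divide_self[OF fact_nonzero])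
      then show ?thesis using True by (simp only: p_def poly_smult refl if_True)
    qed
    then show ?thesis using d by simp
  qed
  let ?n = "degree p"
  \<comment> \<open>As \<open>degree p \<le> d\<close>, the half-plane \<open>Re s > a\<close>
    contains the one in the definition of \<open>sphere_zeta\<close>.\<close>
  define a where "a = real ?n + 1 / 2"
  have a: "a \<le> real k / 2" using deg by (simp add: a_def k)
  have "\<exists>g. g meromorphic_on {s. Re s > a - real L} \<and> g analytic_on {s. Re s > a} \<and>
        (\<forall>s. Re s > a \<longrightarrow> g s = F s) \<and> (a < real L \<longrightarrow> g analytic_on {0} \<and> g 0 = -1)" for L
  proof -
    obtain g where "g meromorphic_on {s. Re s > a - real L}" "g analytic_on {s. Re s > a}"
      "\<And>s. Re s > a \<Longrightarrow> g s = F s" "a < real L \<Longrightarrow> g analytic_on {0}" "a < real L \<Longrightarrow> g 0 = - poly p 0 / 2 - 1"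
      using shifted_series_continuation[of p L d, folded a_def F_def, unfolded vals] by blast
    then show ?thesis using p0 by (intro exI[of _ g]) auto
  qed
  then obtain g where g: "\<And>L. g L meromorphic_on {s. Re s > a - real L}" "\<And>L. g L analytic_on {s. Re s > a}"
       "\<And>L s. Re s > a \<Longrightarrow> g L s = F s" "\<And>L. a < real L \<Longrightarrow> g L analytic_on {0} \<and> g L 0 = -1"
    by metis
  obtain G where G: "G nicely_meromorphic_on UNIV" "\<And>s. Re s > a \<Longrightarrow> G s = F s"
    using nicely_meromorphic_on_glue[of g a F] g by blast
  have "sphere_zeta k = G"
    unfolding sphere_zeta_def F
  proof (rule the_equality)
    show "G nicely_meromorphic_on UNIV \<and> (\<forall>s. Re s > real k / 2 \<longrightarrow> G s = F s)"
      using G a by auto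
  next
    fix f assume f: "f nicely_meromorphic_on UNIV \<and> (\<forall>s. Re s > real k / 2 \<longrightarrow> f s = F s)"
    show "f = G"
    proof
      fix s
      show "f s = G s"
      proof (rule nicely_meromorphic_on_unique[where A = UNIV and U = "{s. Re s > real k / 2}" and f = f and g = G])
        show "f s = G s" if "s \<in> {s. Re s > real k / 2}" for s
          using that f G(2)[of s] a by simp
      qed (simp_all only: f G(1) open_UNIV connected_UNIV Re_gt_nonempty open_Re_gt subset_UNIV UNIV_I not_False_eq_True)
    qed
  qed
  moreover have "G 0 = -1"
  proof -
    \<comment> \<open>This \<open>L\<close> is large enough for 0 to lie in the half-plane. Since
      \<open>g ?L\<close> is analytic at 0, \<open>remove_sings\<close> leaves its value there
      unchanged.\<close>
    let ?L = "?n + 1" and ?H = "{s. Re s > a - real (?n + 1)}"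
    have L: "a < real ?L" by (simp add: a_def)
    have "remove_sings (g ?L) 0 = G 0"
    proof (rule nicely_meromorphic_on_unique[where A = ?H and U = "{s. Re s > a}" and f = "remove_sings (g ?L)" and g = G])
      show "remove_sings (g ?L) nicely_meromorphic_on ?H"
        by (rule remove_sings_nicely_meromorphic[OF g(1)])
      show "G nicely_meromorphic_on ?H"
        by (rule nicely_meromorphic_on_subset[OF G(1)]) auto
      show "connected ?H" by (intro convex_connected convex_halfspace_Re_gt)
      show "remove_sings (g ?L) s = G s" if "s \<in> {s. Re s > a}" for s
        using that G(2) g(3) analytic_on_subset[OF g(2), of "{s}"] by simp
      show "0 \<in> ?H" using L by simp
      show "{s. Re s > a} \<subseteq> ?H" by auto
    qed (simp_all only: Re_gt_nonempty open_Re_gt not_False_eq_True)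
    then show ?thesis using g(4)[OF L] by simp
  qed
  ultimately show ?thesis by simp
qed

end
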